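(* Let $\lambda \geq 5$ and let $G \in ER(n,d,\lambda)$ have a uniform shared neighborhood structure isomorphic to the path $P_\lambda$. Let $u \sim v$ in $G$ with $N(u)\cap N(v) = \{w_1,\dots,w_\lambda\}$, where $w_1$ is an endpoint of the path $G[N(u)\cap N(v)]$. If $w_1 \sim w_2$, then $N(w_1)\cap N(w_2)$ contains exactly one vertex from $N(u)\setminus (N(v)\cup\{v\})$ and exactly one vertex from $N(v)\setminus(N(u)\cup\{u\})$.
   Context: For a finite simple graph $G$, $N(u)$ is the open neighborhood of a vertex $u$. $G \in ER(n,d,\lambda)$ means $G$ has $n$ vertices, is $d$-regular, and every pair of adjacent vertices has exactly $\lambda$ common neighbors. $G$ has a uniform shared neighborhood structure isomorphic to $H$ if the induced subgraph $G[N(u)\cap N(v)]$ is isomorphic to $H$ for all adjacent $u,v$. $P_m$ is the path graph on $m$ vertices. *)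

theory Defs
  imports "Graph_Theory.Graph_Theory"
begin

text \<open>Finite simple graphs are the library's \<^const>\<open>pair_graph\<close>s: finite, loop-free digraphs with a
  symmetric arc set and no parallel arcs. An undirected edge is thus a pair of opposite arcs.\<close>

definition nbhd :: "'a pair_pre_digraph \<Rightarrow> 'a \<Rightarrow> 'a set" where
  "nbhd G u = {x \<in> pverts G. (u, x) \<in> parcs G}"

definition edge_regular :: "'a pair_pre_digraph \<Rightarrow> nat \<Rightarrow> nat \<Rightarrow> nat \<Rightarrow> bool" where
  "edge_regular G n d l \<longleftrightarrow>
     pair_graph G \<and>
     card (pverts G) = n \<and>
     (\<forall>u \<in> pverts G. card (nbhd G u) = d) \<and>
     (\<forall>u v. (u, v) \<in> parcs G \<longrightarrow> card (nbhd G u \<inter> nbhd G v) = l)"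

definition uniform_shared_nbhd :: "'a pair_pre_digraph \<Rightarrow> 'b pair_pre_digraph \<Rightarrow> bool" where
  "uniform_shared_nbhd G H \<longleftrightarrow>
     (\<forall>u v. (u, v) \<in> parcs G \<longrightarrow>
        digraph_iso (with_proj G \<restriction> (nbhd G u \<inter> nbhd G v)) (with_proj H))"

definition path_graph :: "nat \<Rightarrow> nat pair_pre_digraph" where
  "path_graph m = \<lparr> pverts = {..<m},
     parcs = {(i, j). i < m \<and> j < m \<and> (j = Suc i \<or> i = Suc j)} \<rparr>"

lemma pair_graph_path_graph: "pair_graph (path_graph m)"
proof -
  have "parcs (path_graph m) \<subseteq> {..<m} \<times> {..<m}"
    by (auto simp: path_graph_def)
  then have "finite (parcs (path_graph m))"
    by (rule finite_subset) simp
  then show ?thesis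
    by unfold_locales (auto simp: path_graph_def symmetric_def sym_def)
qed

text \<open>\<open>x\<close> is an endpoint of the path \<open>H\<close>: some isomorphism of \<open>H\<close> onto a path graph sends \<open>x\<close> to the
  first or the last vertex.\<close>

definition path_endpoint :: "('a, 'b) pre_digraph \<Rightarrow> 'a \<Rightarrow> bool" where
  "path_endpoint H x \<longleftrightarrow>
     (\<exists>m f. pre_digraph.digraph_isomorphism H f \<and>
            with_proj (path_graph m) = app_iso f H \<and>
            x \<in> verts H \<and>
            (iso_verts f x = 0 \<or> iso_verts f x = m - 1))"

end

theory Submission
  imports Defs
begin

text \<open>In the path on \<open>N(w\<^sub>1) \<inter> N(w\<^sub>2)\<close> the vertex \<open>u\<close> has at most one neighbour other than \<open>v\<close>, which
  gives uniqueness. For existence, \<open>v w\<^sub>2\<close> is an edge of the path on \<open>N(u) \<inter> N(w\<^sub>1)\<close>, which has at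
  least three vertices, so some third vertex \<open>z\<close> of it is adjacent to \<open>v\<close> or to \<open>w\<^sub>2\<close>. It is not
  adjacent to \<open>v\<close>, since \<open>w\<^sub>2\<close> is the only neighbour of the endpoint \<open>w\<^sub>1\<close> in \<open>N(u) \<inter> N(v)\<close>; so it
  is adjacent to \<open>w\<^sub>2\<close> and is the required vertex.\<close>

text \<open>An isomorphism onto a path reduced to its vertex map: adjacency becomes arithmetic of
  positions, which \<open>linarith\<close> can settle, and arc maps disappear from the
  argument.\<close>

definition path_labelling :: "'a pair_pre_digraph \<Rightarrow> 'a set \<Rightarrow> nat \<Rightarrow> ('a \<Rightarrow> nat) \<Rightarrow> bool" where
  "path_labelling G S m f \<longleftrightarrow>
     bij_betw f S {..<m} \<and>
     (\<forall>x \<in> S. \<forall>y \<in> S. (x, y) \<in> parcs G \<longleftrightarrow> f y = Suc (f x) \<or> f x = Suc (f y))"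

lemma path_labelling_of_iso:
  assumes iso: "pre_digraph.digraph_isomorphism (with_proj G \<restriction> S) h"
    and img: "with_proj (path_graph m) = app_iso h (with_proj G \<restriction> S)"
  shows "path_labelling G S m (iso_verts h)"
proof -
  let ?H = "with_proj G \<restriction> S" and ?f = "iso_verts h"
  have injv: "inj_on ?f S"
    and tail: "\<And>a. a \<in> arcs ?H \<Longrightarrow> iso_tail h (iso_arcs h a) = ?f (tail ?H a)"
    and head: "\<And>a. a \<in> arcs ?H \<Longrightarrow> iso_head h (iso_arcs h a) = ?f (head ?H a)"
    using iso by (auto simp: pre_digraph.digraph_isomorphism_def)
  have verts_eq: "?f ` S = {..<m}"
    using arg_cong[OF img, of verts] by (simp add: path_graph_def)
  have arcs_eq: "iso_arcs h ` arcs ?H = parcs (path_graph m)"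
    using arg_cong[OF img, of arcs] by simp
  \<comment> \<open>Arcs of the path graph are pairs, so comparing the \<open>tail\<close> and
    \<open>head\<close> fields of \<open>img\<close> forces the arc map to act by the vertex map on
    both ends.\<close>
  have "iso_tail h = fst" "iso_head h = snd"
    using arg_cong[OF img, of tail] arg_cong[OF img, of head] by simp_all
  then have arc: "iso_arcs h (x, y) = (?f x, ?f y)" if "(x, y) \<in> arcs ?H" for x y
    using tail[OF that] head[OF that] by (simp add: prod_eq_iff)
  have "(x, y) \<in> parcs G \<longleftrightarrow> (?f x, ?f y) \<in> parcs (path_graph m)" if xy: "x \<in> S" "y \<in> S" for x y
  proof
    assume "(x, y) \<in> parcs G"
    then have "(x, y) \<in> arcs ?H" using xy by simp
    then show "(?f x, ?f y) \<in> parcs (path_graph m)"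
      using arc arcs_eq by (metis image_eqI)
  next
    assume "(?f x, ?f y) \<in> parcs (path_graph m)"
    \<comment> \<open>An arc of the path has some preimage arc; injectivity on vertices identifies
      its ends with \<open>x\<close> and \<open>y\<close>.\<close>
    then obtain a b where ab: "(a, b) \<in> arcs ?H" "iso_arcs h (a, b) = (?f x, ?f y)"
      using arcs_eq by (metis imageE surj_pair)
    then have "a \<in> S" "b \<in> S" "?f a = ?f x" "?f b = ?f y"
      using arc by auto
    then have "a = x" "b = y" using injv xy by (auto dest: inj_onD)
    then show "(x, y) \<in> parcs G" using ab by simp
  qed
  moreover have "?f x < m" if "x \<in> S" for x
    using verts_eq that by blast
  ultimately show ?thesis
    using injv verts_eq by (auto simp: path_labelling_def bij_betw_def path_graph_def)
qed

text \<open>Only two positions are next to that of \<open>x\<close>; \<open>a\<close> takes one of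
  them, so \<open>b\<close> and \<open>c\<close> share the other.\<close>

lemma path_labelling_degree_le_2:
  assumes lab: "path_labelling G S m f" and "x \<in> S" "a \<in> S" "b \<in> S" "c \<in> S"
    and "(x, a) \<in> parcs G" "(x, b) \<in> parcs G" "(x, c) \<in> parcs G"
    and "a \<noteq> b" "a \<noteq> c"
  shows "b = c"
proof -
  have inj: "inj_on f S" using lab by (simp add: path_labelling_def bij_betw_def)
  have "f a \<noteq> f b" "f a \<noteq> f c" using assms inj by (auto dest: inj_onD)
  moreover have "f a = Suc (f x) \<or> f x = Suc (f a)" "f b = Suc (f x) \<or> f x = Suc (f b)"
    "f c = Suc (f x) \<or> f x = Suc (f c)"
    using assms by (simp_all add: path_labelling_def)
  ultimately have "f b = f c" by linarith
  then show ?thesis using assms inj by (auto dest: inj_onD)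
qed

text \<open>Position \<open>0\<close> has no predecessor, and the successor of \<open>m - 1\<close>
  falls outside the range.\<close>

lemma path_labelling_endpoint_degree_le_1:
  assumes lab: "path_labelling G S m f" and "x \<in> S" "a \<in> S" "b \<in> S"
    and "f x = 0 \<or> f x = m - 1"
    and "(x, a) \<in> parcs G" "(x, b) \<in> parcs G"
  shows "a = b"
proof -
  have inj: "inj_on f S" and "f ` S = {..<m}"
    using lab by (simp_all add: path_labelling_def bij_betw_def)
  then have "f a < m" "f b < m" using assms(3,4) by blast+
  moreover have "f a = Suc (f x) \<or> f x = Suc (f a)" "f b = Suc (f x) \<or> f x = Suc (f b)"
    using assms by (simp_all add: path_labelling_def)
  ultimately have "f a = f b" using assms(5) by linarith
  then show ?thesis using assms inj by (auto dest: inj_onD)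
qed

lemma path_labelling_edge_extends:
  assumes lab: "path_labelling G S m f" and "3 \<le> m" "x \<in> S" "y \<in> S" "(x, y) \<in> parcs G"
  obtains z where "z \<in> S" "z \<noteq> x" "z \<noteq> y" "(z, x) \<in> parcs G \<or> (z, y) \<in> parcs G"
proof -
  define i where "i = min (f x) (f y)"
  \<comment> \<open>Equality of sets leaves open which of \<open>x\<close> and \<open>y\<close>
    comes first along the path.\<close>
  have xy: "{f x, f y} = {i, Suc i}"
  proof -
    have "f y = Suc (f x) \<or> f x = Suc (f y)"
      using assms by (simp add: path_labelling_def)
    then show ?thesis by (auto simp: i_def)
  qed
  have "f ` S = {..<m}" using lab by (simp add: path_labelling_def bij_betw_def)
  then have "f x < m" "f y < m" using assms(3,4) by blast+
  then have "Suc i < m" using xy by (auto simp: doubleton_eq_iff)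
  \<comment> \<open>The position just before the edge or, if the edge begins the path, the one just
    after it, which exists because \<open>m\<close> is at least 3.\<close>
  define k where "k = (if i = 0 then 2 else i - 1)"
  have "k < m" using \<open>Suc i < m\<close> \<open>3 \<le> m\<close> by (auto simp: k_def)
  then have "k \<in> f ` S" using \<open>f ` S = {..<m}\<close> by simp
  then obtain z where z: "z \<in> S" "f z = k" by auto
  show thesis
  proof (rule that)
    show "z \<in> S" by fact
    show "z \<noteq> x" "z \<noteq> y" using xy z by (auto simp: k_def doubleton_eq_iff split: if_splits)
    show "(z, x) \<in> parcs G \<or> (z, y) \<in> parcs G"
    proof -
      have "(z, t) \<in> parcs G \<longleftrightarrow> f t = Suc k \<or> k = Suc (f t)" if "t \<in> S" for t
        using lab z that by (simp add: path_labelling_def)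
      then show ?thesis
        using assms(3,4) xy by (auto simp: k_def doubleton_eq_iff)
    qed
  qed
qed

lemma uniform_shared_nbhd_pathE:
  assumes "uniform_shared_nbhd G (path_graph l)" "(u, v) \<in> parcs G"
  obtains f where "path_labelling G (nbhd G u \<inter> nbhd G v) l f"
  using assms path_labelling_of_iso unfolding uniform_shared_nbhd_def digraph_iso_def by metis

lemma path_endpointE:
  assumes "path_endpoint (with_proj G \<restriction> S) x"
  obtains m f where "path_labelling G S m f" "x \<in> S" "f x = 0 \<or> f x = m - 1"
proof -
  from assms obtain m h where "pre_digraph.digraph_isomorphism (with_proj G \<restriction> S) h"
    "with_proj (path_graph m) = app_iso h (with_proj G \<restriction> S)"
    "x \<in> S" "iso_verts h x = 0 \<or> iso_verts h x = m - 1"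
    unfolding path_endpoint_def by auto
  then show thesis using that path_labelling_of_iso by metis
qed

text \<open>One half of the theorem; exchanging \<open>u\<close> and \<open>v\<close> gives the
  other.\<close>

lemma ex1_private_shared_neighbour:
  assumes l: "3 \<le> l" and G: "pair_graph G"
    and unif: "uniform_shared_nbhd G (path_graph l)"
    and uv: "(u, v) \<in> parcs G"
    and endpt: "path_endpoint (with_proj G \<restriction> (nbhd G u \<inter> nbhd G v)) a"
    and b: "b \<in> nbhd G u \<inter> nbhd G v" and ab: "(a, b) \<in> parcs G"
  shows "\<exists>!x. x \<in> (nbhd G a \<inter> nbhd G b) \<inter> (nbhd G u - (nbhd G v \<union> {v}))"
proof -
  interpret pair_graph G by fact
  let ?S = "nbhd G u \<inter> nbhd G v"
  have sym: "(y, x) \<in> parcs G" if "(x, y) \<in> parcs G" for x y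
    using that by (rule arcs_symmetric)
  have nb: "y \<in> nbhd G x \<longleftrightarrow> (x, y) \<in> parcs G" for x y
    using in_arcsD2 by (auto simp: nbhd_def)
  \<comment> \<open>This labelling has the length \<open>m\<close> supplied by the endpoint
    hypothesis; \<open>g\<close> and \<open>p\<close> below come from uniformity and have length
    \<open>l\<close>.\<close>
  obtain m f where f: "path_labelling G ?S m f" "a \<in> ?S" "f a = 0 \<or> f a = m - 1"
    using endpt by (rule path_endpointE)
  have a_leaf: "z = b" if "z \<in> ?S" "(a, z) \<in> parcs G" for z
    using path_labelling_endpoint_degree_le_1[OF f(1,2) _ b f(3)] that ab by blast
  have arcs: "(u, a) \<in> parcs G" "(v, a) \<in> parcs G" "(u, b) \<in> parcs G" "(v, b) \<in> parcs G"
    using f(2) b by (auto simp: nb)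
  obtain g where g: "path_labelling G (nbhd G u \<inter> nbhd G a) l g"
    using unif arcs(1) by (rule uniform_shared_nbhd_pathE)
  obtain z where z: "z \<in> nbhd G u \<inter> nbhd G a" "z \<noteq> v" "z \<noteq> b"
    "(z, v) \<in> parcs G \<or> (z, b) \<in> parcs G"
    using path_labelling_edge_extends[OF g l, of v b] arcs uv ab sym by (auto simp: nb)
  \<comment> \<open>Otherwise \<open>z\<close> would lie in \<open>?S\<close> as a neighbour of
    \<open>a\<close> other than \<open>b\<close>.\<close>
  have "(z, v) \<notin> parcs G"
    using a_leaf[of z] z sym by (auto simp: nb)
  then have zb: "(b, z) \<in> parcs G" "z \<notin> nbhd G v"
    using z(4) sym by (auto simp: nb)
  obtain p where p: "path_labelling G (nbhd G a \<inter> nbhd G b) l p"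
    using unif ab by (rule uniform_shared_nbhd_pathE)
  show ?thesis
  proof (rule ex1I)
    show "z \<in> (nbhd G a \<inter> nbhd G b) \<inter> (nbhd G u - (nbhd G v \<union> {v}))"
      using z zb by (auto simp: nb)
    \<comment> \<open>On the path \<open>p\<close> the vertex \<open>u\<close> has the neighbours
      \<open>v\<close>, \<open>x\<close> and \<open>z\<close>, and \<open>v\<close> differs from the
      other two.\<close>
    show "x = z" if "x \<in> (nbhd G a \<inter> nbhd G b) \<inter> (nbhd G u - (nbhd G v \<union> {v}))" for x
      using path_labelling_degree_le_2[OF p, of u v x z] that z zb arcs uv sym by (auto simp: nb)
  qed
qed

theorem theorem4:
  fixes G :: "'a pair_pre_digraph"
    and n d l :: nat
    and u v :: 'a
    and w :: "nat \<Rightarrow> 'a"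
  assumes "l \<ge> 5"
    and "edge_regular G n d l"
    and "uniform_shared_nbhd G (path_graph l)"
    and "(u, v) \<in> parcs G"
    and "nbhd G u \<inter> nbhd G v = w ` {1..l}"
    and "path_endpoint (with_proj G \<restriction> (nbhd G u \<inter> nbhd G v)) (w 1)"
    and "(w 1, w 2) \<in> parcs G"
  shows "(\<exists>!x. x \<in> (nbhd G (w 1) \<inter> nbhd G (w 2)) \<inter> (nbhd G u - (nbhd G v \<union> {v}))) \<and>
         (\<exists>!y. y \<in> (nbhd G (w 1) \<inter> nbhd G (w 2)) \<inter> (nbhd G v - (nbhd G u \<union> {u})))"
proof -
  have l: "3 \<le> l" and G: "pair_graph G"
    using assms(1,2) by (auto simp: edge_regular_def)
  then interpret pair_graph G by simp
  have vu: "(v, u) \<in> parcs G" using assms(4) by (rule arcs_symmetric)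
  have w2: "w 2 \<in> nbhd G u \<inter> nbhd G v" unfolding assms(5) using assms(1) by auto
  show ?thesis
    using ex1_private_shared_neighbour[OF l G assms(3,4,6) w2 assms(7)]
      ex1_private_shared_neighbour[OF l G assms(3) vu _ _ assms(7)] assms(6) w2
    by (simp add: Int_commute)
qed

end
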